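(* Let $\alpha\in\mathbb R$ be a cubic irrationality and $\alpha_{n+1}$ the tails in its continued fraction $\alpha=[a_1,\dots,a_n,\alpha_{n+1}]$, where $n=0,1,2,\dots$\,. Then for the conjugates $\sigma_1(\alpha_{n+1}),\sigma_2(\alpha_{n+1})$ we have the following limit relation: \[ q_n^2\cdot|\sigma_1(\alpha_{n+1})-\sigma_2(\alpha_{n+1})|\to\beta=\bigg|\frac{\sigma_1(\alpha)-\sigma_2(\alpha)}{(\alpha-\sigma_1(\alpha))(\alpha-\sigma_2(\alpha))}\bigg| \quad\text{as}\; n\to\infty. \]
   Context: For a real irrational $\alpha$, the continued fraction is defined by $a_1=\lfloor\alpha\rfloor$, $\alpha=a_1+1/\alpha_2$ with $\alpha_2>1$, and inductively $a_n=\lfloor\alpha_n\rfloor$, $\alpha_n=a_n+1/\alpha_{n+1}$ with $\alpha_{n+1}>1$; thus $\alpha=[a_1,\dots,a_n,\alpha_{n+1}]$ for $n=0,1,2,\dots$ (with $\alpha_1=\alpha$). The $n$th convergent is $p_n/q_n=[a_1,\dots,a_n]$, where $\begin{pmatrix} p_n & p_{n-1} \\ q_n & q_{n-1}\end{pmatrix}=\begin{pmatrix} a_1 & 1 \\ 1 & 0\end{pmatrix}\dotsb\begin{pmatrix} a_n & 1 \\ 1 & 0\end{pmatrix}$ for $n\ge1$, with conventions $p_0=1$, $q_0=0$. For $\gamma\in K=\mathbb Q(\alpha)$, $\sigma_1(\gamma),\sigma_2(\gamma)$ denote the two conjugates of $\gamma$ different from $\gamma$. *)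

theory Defs
  imports
    "HOL-Analysis.Analysis"
    "HOL-Computational_Algebra.Polynomial_Factorial"
begin

definition rat_min_poly :: "'a::field_char_0 \<Rightarrow> rat poly" where
  "rat_min_poly x =
     (THE p. lead_coeff p = 1 \<and> irreducible p \<and> poly (map_poly of_rat p) x = 0)"

(* The guard "algebraic" is needed because rat_min_poly is unspecified at transcendental arguments. *)
definition cubic_irrationality :: "real \<Rightarrow> bool" where
  "cubic_irrationality x \<longleftrightarrow> algebraic x \<and> degree (rat_min_poly x) = 3"

definition conjugates :: "real \<Rightarrow> complex set" where
  "conjugates x = {z. poly (map_poly of_rat (rat_min_poly x)) z = 0}"

definition is_subfield :: "'a::field set \<Rightarrow> bool" where
  "is_subfield F \<longleftrightarrow> 0 \<in> F \<and> 1 \<in> F \<and>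
     (\<forall>x\<in>F. \<forall>y\<in>F. x - y \<in> F \<and> x * y \<in> F) \<and> (\<forall>x\<in>F. inverse x \<in> F)"

(* The field Q(x): the smallest subfield containing x; in characteristic 0
   every subfield contains the rationals. *)
definition rat_adjoin :: "'a::field_char_0 \<Rightarrow> 'a set" where
  "rat_adjoin x = \<Inter> {F. is_subfield F \<and> x \<in> F}"

(* Tails are counted by the number of partial quotients removed, partial quotients from 1:
   cf_tail x n is x_(n+1) in x = [a_1, ..., a_n, x_(n+1)], so a_n = floor (cf_tail x (n - 1)). *)
primrec cf_tail :: "real \<Rightarrow> nat \<Rightarrow> real" where
  "cf_tail x 0 = x"
| "cf_tail x (Suc n) = 1 / (cf_tail x n - of_int \<lfloor>cf_tail x n\<rfloor>)"

definition cf_quotient :: "real \<Rightarrow> nat \<Rightarrow> int" where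
  "cf_quotient x n = \<lfloor>cf_tail x (n - 1)\<rfloor>"

(* The matrix with rows (p_n, p_(n-1)) and (q_n, q_(n-1)); the empty product at n = 0
   gives the conventions p_0 = 1, q_0 = 0. *)
primrec cf_matrix :: "real \<Rightarrow> nat \<Rightarrow> int^2^2" where
  "cf_matrix x 0 = mat 1"
| "cf_matrix x (Suc n) =
     cf_matrix x n ** vector [vector [cf_quotient x (Suc n), 1], vector [1, 0]]"

definition cf_num :: "real \<Rightarrow> nat \<Rightarrow> int" where
  "cf_num x n = cf_matrix x n $ 1 $ 1"

definition cf_denom :: "real \<Rightarrow> nat \<Rightarrow> int" where
  "cf_denom x n = cf_matrix x n $ 2 $ 1"

end

theory Submission
  imports Defs "HOL-Computational_Algebra.Field_as_Ring"
begin

text \<open>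
  The Moebius transformation taking \<open>\<alpha>\<close> to its tail \<open>\<alpha>\<^sub>n\<^sub>+\<^sub>1\<close> has rational coefficients, so it
  takes the conjugates of \<open>\<alpha>\<close> to those of \<open>\<alpha>\<^sub>n\<^sub>+\<^sub>1\<close>. It sends \<open>z\<close> to
  \<open>- (q\<^sub>n\<^sub>-\<^sub>1 z - p\<^sub>n\<^sub>-\<^sub>1) / (q\<^sub>n z - p\<^sub>n)\<close> and its determinant is \<open>\<plusminus>1\<close>, so the images of \<open>y\<close> and \<open>z\<close>
  differ, up to sign, by \<open>(y - z) / ((q\<^sub>n y - p\<^sub>n) (q\<^sub>n z - p\<^sub>n))\<close>. Multiplying by \<open>q\<^sub>n\<^sup>2\<close> and using
  \<open>p\<^sub>n / q\<^sub>n \<rightarrow> \<alpha>\<close> yields the limit.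
\<close>

section \<open>Minimal polynomials over the rationals\<close>

abbreviation rpoly :: "rat poly \<Rightarrow> 'a \<Rightarrow> 'a::field_char_0" where
  "rpoly p x \<equiv> poly (map_poly of_rat p) x"

lemma rpoly_add: "rpoly (p + q) x = rpoly p x + rpoly q x"
proof -
  have "map_poly of_rat (p + q) = map_poly of_rat p + (map_poly of_rat q :: 'a poly)"
    by (intro poly_eqI) (simp add: coeff_map_poly of_rat_add)
  then show ?thesis by simp
qed

lemma rpoly_mult: "rpoly (p * q) x = rpoly p x * rpoly q x"
  by (induction p)
    (simp_all add: rpoly_add map_poly_pCons map_poly_smult of_rat_mult algebra_simps)

lemma rpoly_pcompose: "rpoly (pcompose p q) x = rpoly p (rpoly q x)"
  by (induction p) (simp_all add: pcompose_pCons rpoly_add rpoly_mult map_poly_pCons)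

lemma rpoly_reflect_poly:
  assumes "x \<noteq> 0"
  shows "rpoly (reflect_poly p) x = x ^ degree p * rpoly p (inverse x)"
proof -
  have deg: "degree (map_poly of_rat p :: 'a poly) = degree p"
    by (rule degree_map_poly) simp
  have "map_poly of_rat (reflect_poly p) = (reflect_poly (map_poly of_rat p) :: 'a poly)"
    by (intro poly_eqI) (simp add: coeff_map_poly coeff_reflect_poly deg)
  then show ?thesis using assms by (simp add: poly_reflect_poly_nz deg)
qed

lemma rpoly_of_real: "rpoly p (of_real x) = (of_real (rpoly p x) :: 'a::real_field)"
proof -
  have "of_rat r = (of_real (of_rat r) :: 'a)" for r
    by (cases r) (simp add: of_rat_rat)
  then show ?thesis by (induction p) (simp_all add: map_poly_pCons)
qed

lemma algebraic_iff_rpoly: "algebraic x \<longleftrightarrow> (\<exists>p. p \<noteq> 0 \<and> rpoly p x = 0)"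
proof
  assume "algebraic x"
  then obtain p where p: "p \<noteq> 0" "poly (map_poly of_int p) x = 0" by (rule algebraicE')
  have "map_poly of_rat (map_poly of_int p) = (map_poly of_int p :: 'a poly)"
    by (simp add: map_poly_map_poly comp_def)
  moreover have "map_poly of_int p \<noteq> (0 :: rat poly)"
    using p(1) by (subst map_poly_eq_0_iff) auto
  ultimately show "\<exists>p. p \<noteq> 0 \<and> rpoly p x = 0" using p(2) by metis
next
  assume "\<exists>p. p \<noteq> 0 \<and> rpoly p x = 0"
  then obtain p where p: "p \<noteq> 0" "rpoly p x = 0" by blast
  show "algebraic x"
  proof (rule algebraicI')
    show "coeff (map_poly of_rat p) i \<in> \<rat>" for i by (simp add: coeff_map_poly)
    show "map_poly of_rat p \<noteq> (0 :: 'a poly)"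
      using p(1) by (subst map_poly_eq_0_iff) auto
  qed (fact p(2))
qed

lemma irreducible_dvd_iff_rpoly_eq_0:
  assumes "irreducible m" "rpoly m x = 0"
  shows "m dvd p \<longleftrightarrow> rpoly p x = 0"
proof
  assume "m dvd p"
  then show "rpoly p x = 0" using assms(2) by (auto simp: rpoly_mult)
next
  assume root: "rpoly p x = 0"
  show "m dvd p"
  proof (rule ccontr)
    assume "\<not> m dvd p"
    then have "coprime m p"
      using assms(1) by (intro prime_elem_imp_coprime irreducible_imp_prime_elem)
    then obtain a b where "a * m + b * p = 1"
      by (metis bezout_coefficients_fst_snd coprime_imp_gcd_eq_1)
    then have "rpoly a x * rpoly m x + rpoly b x * rpoly p x = rpoly 1 x"
      by (metis rpoly_add rpoly_mult)
    then show False using assms(2) root by simp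
  qed
qed

lemma rpoly_prime_root_exists:
  assumes "p \<noteq> 0" "rpoly p x = 0"
  shows "\<exists>q. prime q \<and> rpoly q x = 0"
  using assms
proof (induction p rule: prime_divisors_induct)
  case (unit p)
  then show ?case by (auto simp: is_unit_poly_iff map_poly_pCons)
next
  case (factor q p)
  then show ?case by (auto simp: rpoly_mult)
qed simp

lemma rat_min_poly_eqI:
  assumes "lead_coeff m = 1" "irreducible m" "rpoly m x = 0"
  shows "rat_min_poly x = m"
  unfolding rat_min_poly_def
proof (rule the_equality)
  fix p assume p: "lead_coeff p = 1 \<and> irreducible p \<and> rpoly p x = 0"
  then have "p dvd m" "m dvd p"
    using assms irreducible_dvd_iff_rpoly_eq_0 by blast+
  moreover have "normalize q = q" if "lead_coeff q = 1" for q :: "rat poly"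
    by (simp only: normalize_poly_eq_map_poly that unit_factor_1 div_by_1 map_poly_id')
  ultimately show "p = m" using p assms(1) by (blast intro: associated_eqI)
qed (use assms in simp)

lemma
  assumes "algebraic x"
  shows irreducible_rat_min_poly: "irreducible (rat_min_poly x)"
    and rpoly_rat_min_poly: "rpoly (rat_min_poly x) x = 0"
proof -
  obtain p where "p \<noteq> 0" "rpoly p x = 0"
    using assms by (auto simp: algebraic_iff_rpoly)
  then obtain m where m: "prime m" "rpoly m x = 0"
    using rpoly_prime_root_exists by blast
  have "irreducible m" using m(1) by (simp add: prime_elem_imp_irreducible)
  moreover have "lead_coeff m = 1"
    using unit_factor_prime[OF m(1)] by (simp add: unit_factor_poly_def one_pCons)
  ultimately show "irreducible (rat_min_poly x)" "rpoly (rat_min_poly x) x = 0"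
    using rat_min_poly_eqI m(2) by metis+
qed

lemma rat_min_poly_of_rat: "rat_min_poly (of_rat r) = [:- r, 1:]"
  by (rule rat_min_poly_eqI)
    (simp_all add: irreducible_linear_field_poly map_poly_pCons of_rat_minus)

lemma cubic_irrationality_not_Rats:
  assumes "cubic_irrationality x"
  shows "x \<notin> \<rat>"
  using assms by (auto simp: cubic_irrationality_def rat_min_poly_of_rat elim: Rats_cases)

section \<open>Conjugates\<close>

lemma conjugates_iff:
  assumes "algebraic x"
  shows "z \<in> conjugates x \<longleftrightarrow> (\<forall>p. rpoly p z = 0 \<longleftrightarrow> rpoly p x = 0)"
proof
  assume "z \<in> conjugates x"
  then have "rpoly (rat_min_poly x) z = 0" by (simp add: conjugates_def)
  then show "\<forall>p. rpoly p z = 0 \<longleftrightarrow> rpoly p x = 0"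
    using irreducible_dvd_iff_rpoly_eq_0[OF irreducible_rat_min_poly[OF assms]]
      rpoly_rat_min_poly[OF assms] by metis
qed (use rpoly_rat_min_poly[OF assms] in \<open>simp add: conjugates_def\<close>)

lemma of_real_in_conjugates:
  assumes "algebraic x"
  shows "of_real x \<in> conjugates x"
  using assms by (simp add: conjugates_iff rpoly_of_real)

lemma conjugates_not_Rats:
  assumes "algebraic x" "x \<notin> \<rat>" "z \<in> conjugates x"
  shows "z \<notin> \<rat>"
proof
  assume "z \<in> \<rat>"
  then obtain r where "z = of_rat r" by (rule Rats_cases)
  then have "rpoly [:- r, 1:] z = 0" by (simp add: map_poly_pCons of_rat_minus)
  then have "rpoly [:- r, 1:] x = 0" using assms by (simp add: conjugates_iff)
  then show False using assms(2) by (simp add: map_poly_pCons of_rat_minus)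
qed

lemma algebraic_diff_of_rat:
  assumes "algebraic x"
  shows "algebraic (x - of_rat r)"
proof -
  obtain p where p: "p \<noteq> 0" "rpoly p x = 0"
    using assms by (auto simp: algebraic_iff_rpoly)
  have "pcompose p [:r, 1:] \<noteq> 0" using p(1) by (auto dest: pcompose_eq_0)
  moreover have "rpoly (pcompose p [:r, 1:]) (x - of_rat r) = 0"
    using p(2) by (simp add: rpoly_pcompose map_poly_pCons)
  ultimately show ?thesis by (auto simp: algebraic_iff_rpoly)
qed

lemma conjugates_diff_of_rat:
  assumes "algebraic x"
  shows "conjugates (x - of_rat r) = (\<lambda>z. z - of_rat r) ` conjugates x"
proof -
  have diff_in: "z - of_rat r \<in> conjugates (x - of_rat r)"
    if "algebraic x" "z \<in> conjugates x" for x z r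
    unfolding conjugates_iff[OF algebraic_diff_of_rat[OF that(1)]]
  proof
    fix p
    have shift: "rpoly (pcompose p [:- r, 1:]) y = rpoly p (y - of_rat r)"
      for y :: "'b::field_char_0"
      by (simp add: rpoly_pcompose map_poly_pCons of_rat_minus)
    show "rpoly p (z - of_rat r) = 0 \<longleftrightarrow> rpoly p (x - of_rat r) = 0"
      using that by (simp add: conjugates_iff flip: shift)
  qed
  have "z \<in> (\<lambda>z. z - of_rat r) ` conjugates x" if "z \<in> conjugates (x - of_rat r)" for z
    using diff_in[OF algebraic_diff_of_rat[OF assms] that, of "- r"]
    by (intro image_eqI[of _ _ "z + of_rat r"]) (simp_all add: of_rat_minus)
  then show ?thesis using diff_in[OF assms] by blast
qed

lemma conjugates_inverse:
  assumes "algebraic x"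
  shows "conjugates (inverse x) = inverse ` conjugates x"
proof -
  have inverse_in: "inverse z \<in> conjugates (inverse x)"
    if "algebraic x" "z \<in> conjugates x" for x z
  proof -
    have "rpoly [:0, 1:] z = 0 \<longleftrightarrow> rpoly [:0, 1:] x = 0" using that conjugates_iff by blast
    then have zero_iff: "z = 0 \<longleftrightarrow> x = 0" by (simp add: map_poly_pCons)
    have "rpoly p (inverse z) = 0 \<longleftrightarrow> rpoly p (inverse x) = 0" for p
    proof (cases "x = 0")
      case True
      then show ?thesis using that zero_iff by (simp add: conjugates_iff)
    next
      case False
      then have "rpoly (reflect_poly p) z = 0 \<longleftrightarrow> rpoly (reflect_poly p) x = 0"
        using that by (simp add: conjugates_iff)
      then show ?thesis using False zero_iff by (simp add: rpoly_reflect_poly)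
    qed
    then show ?thesis using that(1) by (simp add: conjugates_iff algebraic_inverse)
  qed
  have "z \<in> inverse ` conjugates x" if "z \<in> conjugates (inverse x)" for z
    using inverse_in[OF algebraic_inverse[OF assms] that]
    by (intro image_eqI[of _ _ "inverse z"]) simp_all
  then show ?thesis using inverse_in[OF assms] by blast
qed

section \<open>Tails and convergents of continued fractions\<close>

lemma is_subfield_rat_adjoin: "is_subfield (rat_adjoin x)"
  by (auto simp: is_subfield_def rat_adjoin_def)

lemma is_subfield_of_int:
  assumes "is_subfield F"
  shows "of_int k \<in> F"
proof -
  have diff: "x - y \<in> F" if "x \<in> F" "y \<in> F" for x y
    using assms that by (simp add: is_subfield_def)
  have zero_one: "0 \<in> F" "1 \<in> F" using assms by (auto simp: is_subfield_def)
  have "of_nat n \<in> F" for n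
  proof (induction n)
    case (Suc n)
    have "of_nat n - (0 - 1) \<in> F" using Suc zero_one diff by blast
    then show ?case by (simp add: add.commute)
  qed (use zero_one in simp)
  then show ?thesis using diff[OF zero_one(1)] by (cases k rule: int_cases2) auto
qed

lemma cf_tail_in_rat_adjoin: "cf_tail x n \<in> rat_adjoin x"
proof (induction n)
  case 0
  show ?case by (simp add: rat_adjoin_def)
next
  case (Suc n)
  then show ?case
    using is_subfield_rat_adjoin[of x] is_subfield_of_int[OF is_subfield_rat_adjoin[of x]]
    by (simp add: is_subfield_def divide_inverse)
qed

lemma cf_tail_irrational:
  assumes "x \<notin> \<rat>"
  shows "cf_tail x n \<notin> \<rat>"
proof (induction n)
  case (Suc n)
  show ?case
  proof
    assume "cf_tail x (Suc n) \<in> \<rat>"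
    then have "1 / cf_tail x (Suc n) + of_int \<lfloor>cf_tail x n\<rfloor> \<in> \<rat>"
      by (intro Rats_add Rats_divide) auto
    then show False using Suc by simp
  qed
qed (use assms in simp)

lemma cf_tail_Suc_gt_1:
  assumes "x \<notin> \<rat>"
  shows "cf_tail x (Suc n) > 1"
proof -
  have "cf_tail x n \<noteq> of_int \<lfloor>cf_tail x n\<rfloor>"
    using cf_tail_irrational[OF assms] by (metis Rats_of_int)
  then have "0 < cf_tail x n - of_int \<lfloor>cf_tail x n\<rfloor>" "cf_tail x n - of_int \<lfloor>cf_tail x n\<rfloor> < 1"
    by linarith+
  then show ?thesis by simp
qed

lemma cf_matrix_0_nth:
  "cf_matrix x 0 $ 1 $ 1 = 1" "cf_matrix x 0 $ 1 $ 2 = 0"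
  "cf_matrix x 0 $ 2 $ 1 = 0" "cf_matrix x 0 $ 2 $ 2 = 1"
  by (simp_all add: mat_def)

lemma cf_matrix_Suc_nth:
  "cf_matrix x (Suc n) $ i $ 1 =
     cf_matrix x n $ i $ 1 * \<lfloor>cf_tail x n\<rfloor> + cf_matrix x n $ i $ 2"
  "cf_matrix x (Suc n) $ i $ 2 = cf_matrix x n $ i $ 1"
  by (simp_all add: matrix_matrix_mult_def sum_2 cf_quotient_def)

declare cf_matrix.simps [simp del]

lemma det_cf_matrix: "det (cf_matrix x n) = (- 1) ^ n"
proof (induction n)
  case (Suc n)
  have "det (cf_matrix x (Suc n)) = - det (cf_matrix x n)"
    unfolding det_2 cf_matrix_Suc_nth by (simp add: algebra_simps)
  then show ?case using Suc by simp
qed (simp add: det_2 cf_matrix_0_nth)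

lemma cf_denom_0: "cf_denom x 0 = 0" and cf_denom_1: "cf_denom x (Suc 0) = 1"
  by (simp_all add: cf_denom_def cf_matrix_0_nth cf_matrix_Suc_nth)

lemma cf_denom_Suc_Suc:
  "cf_denom x (Suc (Suc n)) = \<lfloor>cf_tail x (Suc n)\<rfloor> * cf_denom x (Suc n) + cf_denom x n"
  by (simp add: cf_denom_def cf_matrix_Suc_nth mult.commute del: cf_tail.simps)

lemma cf_denom_Suc_pos:
  assumes "x \<notin> \<rat>"
  shows "cf_denom x (Suc n) > 0"
proof -
  have "cf_denom x n \<ge> 0 \<and> cf_denom x (Suc n) > 0"
  proof (induction n)
    case (Suc n)
    have "\<lfloor>cf_tail x (Suc n)\<rfloor> > 0" using cf_tail_Suc_gt_1[OF assms, of n] by linarith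
    then show ?case using Suc by (simp add: cf_denom_Suc_Suc add_pos_nonneg del: cf_tail.simps)
  qed (simp add: cf_denom_0 cf_denom_1)
  then show ?thesis ..
qed

lemma eventually_cf_denom_nonzero:
  assumes "x \<notin> \<rat>"
  shows "eventually (\<lambda>n. cf_denom x n \<noteq> 0) sequentially"
proof (rule eventually_sequentiallyI)
  fix n :: nat assume "1 \<le> n"
  then show "cf_denom x n \<noteq> 0" using cf_denom_Suc_pos[OF assms, of "n - 1"] by simp
qed

lemma cf_denom_Suc_ge:
  assumes "x \<notin> \<rat>"
  shows "cf_denom x (Suc n) \<ge> int n"
proof (induction n)
  case (Suc n)
  have "\<lfloor>cf_tail x (Suc n)\<rfloor> \<ge> 1" using cf_tail_Suc_gt_1[OF assms, of n] by linarith
  then have sum: "cf_denom x (Suc (Suc n)) \<ge> cf_denom x (Suc n) + cf_denom x n"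
    using cf_denom_Suc_pos[OF assms, of n] by (simp add: cf_denom_Suc_Suc del: cf_tail.simps)
  show ?case
  proof (cases n)
    case 0
    then show ?thesis using sum by (simp add: cf_denom_0 cf_denom_1)
  next
    case (Suc k)
    then show ?thesis
      using sum \<open>cf_denom x (Suc n) \<ge> int n\<close> cf_denom_Suc_pos[OF assms, of k] by simp
  qed
qed (simp add: cf_denom_1)

lemma filterlim_cf_denom_at_top:
  assumes "x \<notin> \<rat>"
  shows "filterlim (\<lambda>n. real_of_int (cf_denom x n)) at_top sequentially"
proof -
  have "real n \<le> real_of_int (cf_denom x (Suc n))" for n
    using cf_denom_Suc_ge[OF assms, of n] by linarith
  then have "filterlim (\<lambda>n. real_of_int (cf_denom x (Suc n))) at_top sequentially"
    by (intro filterlim_at_top_mono[OF filterlim_real_sequentially]) simp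
  then show ?thesis by (rule filterlim_sequentially_Suc[THEN iffD1])
qed

section \<open>The transformation taking a number to its tail\<close>

text \<open>\<open>cf_form x n 1 z\<close> is \<open>q\<^sub>n z - p\<^sub>n\<close>, and \<open>cf_form x n 2 z\<close> is \<open>q\<^sub>n\<^sub>-\<^sub>1 z - p\<^sub>n\<^sub>-\<^sub>1\<close>.\<close>

definition cf_form :: "real \<Rightarrow> nat \<Rightarrow> 2 \<Rightarrow> 'a \<Rightarrow> 'a::field_char_0" where
  "cf_form x n j z = of_int (cf_matrix x n $ 2 $ j) * z - of_int (cf_matrix x n $ 1 $ j)"

definition cf_tail_map :: "real \<Rightarrow> nat \<Rightarrow> 'a \<Rightarrow> 'a::field_char_0" where
  "cf_tail_map x n z = - cf_form x n 2 z / cf_form x n 1 z"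

lemma cf_form_0: "cf_form x 0 1 z = - 1" "cf_form x 0 2 z = z"
  unfolding cf_form_def cf_matrix_0_nth by simp_all

lemma cf_form_Suc:
  "cf_form x (Suc n) 1 z = of_int \<lfloor>cf_tail x n\<rfloor> * cf_form x n 1 z + cf_form x n 2 z"
  "cf_form x (Suc n) 2 z = cf_form x n 1 z"
  unfolding cf_form_def cf_matrix_Suc_nth by (simp_all add: algebra_simps)

lemma cf_form_nonzero:
  assumes "z \<notin> \<rat>"
  shows "cf_form x n j z \<noteq> 0"
proof
  assume zero: "cf_form x n j z = 0"
  show False
  proof (cases "cf_matrix x n $ 2 $ j = 0")
    case True
    then have "cf_matrix x n $ 1 $ j = 0" using zero by (simp add: cf_form_def)
    then have "det (cf_matrix x n) = 0" using True exhaust_2[of j] by (auto simp: det_2)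
    then show False by (simp add: det_cf_matrix)
  next
    case False
    then have "z = of_int (cf_matrix x n $ 1 $ j) / of_int (cf_matrix x n $ 2 $ j)"
      using zero by (simp add: cf_form_def field_simps)
    then show False using assms by simp
  qed
qed

lemma cf_tail_map_0: "cf_tail_map x 0 z = z"
  by (simp add: cf_tail_map_def cf_form_0)

lemma cf_tail_map_Suc:
  assumes "z \<notin> \<rat>"
  shows "cf_tail_map x (Suc n) z = inverse (cf_tail_map x n z - of_int \<lfloor>cf_tail x n\<rfloor>)"
proof -
  have "cf_tail_map x n z - of_int \<lfloor>cf_tail x n\<rfloor> = - cf_form x (Suc n) 1 z / cf_form x n 1 z"
    using cf_form_nonzero[OF assms, of x n 1]
    by (simp add: cf_tail_map_def cf_form_Suc field_simps)
  then show ?thesis by (simp add: cf_tail_map_def cf_form_Suc(2))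
qed

lemma cf_tail_map_self:
  assumes "x \<notin> \<rat>"
  shows "cf_tail_map x n x = cf_tail x n"
  by (induction n) (simp_all add: cf_tail_map_0 cf_tail_map_Suc[OF assms] inverse_eq_divide)

lemma cf_tail_map_of_real:
  "cf_tail_map x n (of_real z) = (of_real (cf_tail_map x n z) :: 'a::real_field)"
  by (simp add: cf_tail_map_def cf_form_def)

lemma cf_tail_map_diff:
  assumes "y \<notin> \<rat>" "z \<notin> \<rat>"
  shows "cf_tail_map x n y - cf_tail_map x n z =
           (- 1) ^ n * (y - z) / (cf_form x n 1 y * cf_form x n 1 z)"
proof -
  have "cf_form x n 2 z * cf_form x n 1 y - cf_form x n 2 y * cf_form x n 1 z =
          of_int (det (cf_matrix x n)) * (y - z)"
    unfolding det_2 cf_form_def by (simp add: algebra_simps)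
  then show ?thesis
    using cf_form_nonzero[OF assms(1), of x n 1] cf_form_nonzero[OF assms(2), of x n 1]
    by (simp add: cf_tail_map_def det_cf_matrix divide_simps)
qed

lemma inj_on_cf_tail_map: "inj_on (cf_tail_map x n) (- \<rat>)"
proof (rule inj_onI)
  fix y z :: 'a
  assume irrational: "y \<in> - \<rat>" "z \<in> - \<rat>" and eq: "cf_tail_map x n y = cf_tail_map x n z"
  then have "(- 1) ^ n * (y - z) / (cf_form x n 1 y * cf_form x n 1 z) = 0"
    using cf_tail_map_diff[of y z x n] by simp
  then show "y = z"
    using irrational cf_form_nonzero[of y x n 1] cf_form_nonzero[of z x n 1] by simp
qed

lemma abs_cf_form_le_1:
  assumes "x \<notin> \<rat>"
  shows "\<bar>cf_form x n 1 x\<bar> \<le> 1"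
proof (induction n)
  case (Suc n)
  have "cf_form x n 1 x = - cf_tail x (Suc n) * cf_form x (Suc n) 1 x"
    using cf_tail_map_self[OF assms, of "Suc n"] cf_form_nonzero[OF assms, of x "Suc n" 1]
    by (simp add: cf_tail_map_def cf_form_Suc(2) field_simps del: cf_tail.simps)
  then have "cf_tail x (Suc n) * \<bar>cf_form x (Suc n) 1 x\<bar> = \<bar>cf_form x n 1 x\<bar>"
    using cf_tail_Suc_gt_1[OF assms, of n] by (simp add: abs_mult del: cf_tail.simps)
  moreover have "\<bar>cf_form x (Suc n) 1 x\<bar> \<le> cf_tail x (Suc n) * \<bar>cf_form x (Suc n) 1 x\<bar>"
    using cf_tail_Suc_gt_1[OF assms, of n] by (intro mult_le_cancel_right1[THEN iffD2]) auto
  ultimately show ?case using Suc by linarith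
qed (simp add: cf_form_0)

lemma cf_form_over_cf_denom:
  assumes "cf_denom x n \<noteq> 0"
  shows "cf_form x n 1 z / of_int (cf_denom x n) =
           z - of_int (cf_num x n) / of_int (cf_denom x n)"
  using assms by (simp add: cf_form_def cf_num_def cf_denom_def field_simps)

lemma cf_convergents_tendsto:
  assumes "x \<notin> \<rat>"
  shows "(\<lambda>n. real_of_int (cf_num x n) / real_of_int (cf_denom x n)) \<longlonglongrightarrow> x"
proof (rule Lim_null[THEN iffD2])
  have error: "norm (of_int (cf_num x n) / of_int (cf_denom x n) - x) \<le>
                 norm (1 / real_of_int (cf_denom x n))"
    if "cf_denom x n \<noteq> 0" for n
  proof -
    have "norm (of_int (cf_num x n) / of_int (cf_denom x n) - x) =
            \<bar>cf_form x n 1 x\<bar> / \<bar>real_of_int (cf_denom x n)\<bar>"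
      using cf_form_over_cf_denom[OF that, of x] by (simp add: abs_minus_commute flip: abs_divide)
    also have "\<dots> \<le> 1 / \<bar>real_of_int (cf_denom x n)\<bar>"
      using abs_cf_form_le_1[OF assms] by (intro divide_right_mono) simp_all
    finally show ?thesis by simp
  qed
  have "(\<lambda>n. norm (1 / real_of_int (cf_denom x n))) \<longlonglongrightarrow> 0"
    using filterlim_cf_denom_at_top[OF assms]
    by (intro tendsto_norm_zero real_tendsto_divide_at_top[OF tendsto_const])
  then show "(\<lambda>n. real_of_int (cf_num x n) / real_of_int (cf_denom x n) - x) \<longlonglongrightarrow> 0"
    using eventually_mono[OF eventually_cf_denom_nonzero[OF assms] error]
    by (rule Lim_null_comparison[rotated])
qed

lemma cf_form_over_cf_denom_tendsto:
  fixes z :: "'a::real_normed_field"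
  assumes "x \<notin> \<rat>"
  shows "(\<lambda>n. cf_form x n 1 z / of_int (cf_denom x n)) \<longlonglongrightarrow> z - of_real x"
proof -
  have "(\<lambda>n. z - of_real (of_int (cf_num x n) / of_int (cf_denom x n))) \<longlonglongrightarrow> z - of_real x"
    by (intro tendsto_intros cf_convergents_tendsto assms)
  then show ?thesis
    by (rule Lim_transform_eventually)
      (use eventually_cf_denom_nonzero[OF assms] in
        \<open>auto elim!: eventually_mono simp: cf_form_over_cf_denom\<close>)
qed

lemma cf_tail_map_dist_tendsto:
  fixes y z :: "'a::real_normed_field"
  assumes "x \<notin> \<rat>" "y \<notin> \<rat>" "z \<notin> \<rat>" "y \<noteq> of_real x" "z \<noteq> of_real x"
  shows "(\<lambda>n. (real_of_int (cf_denom x n))\<^sup>2 * norm (cf_tail_map x n y - cf_tail_map x n z))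
           \<longlonglongrightarrow> norm ((y - z) / ((of_real x - y) * (of_real x - z)))"
proof -
  \<comment> \<open>This holds even for \<open>n = 0\<close>, where \<open>q\<^sub>0 = 0\<close> and both sides are \<open>0\<close> as \<open>x / 0 = 0\<close>.\<close>
  have "(real_of_int (cf_denom x n))\<^sup>2 * norm (cf_tail_map x n y - cf_tail_map x n z) =
          norm ((y - z) / ((cf_form x n 1 y / of_int (cf_denom x n)) *
                           (cf_form x n 1 z / of_int (cf_denom x n))))" for n
    using assms
    by (simp add: cf_tail_map_diff norm_mult norm_divide norm_power power2_eq_square)
  moreover have "(\<lambda>n. norm ((y - z) / ((cf_form x n 1 y / of_int (cf_denom x n)) *
                                       (cf_form x n 1 z / of_int (cf_denom x n)))))
      \<longlonglongrightarrow> norm ((y - z) / ((y - of_real x) * (z - of_real x)))"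
    using assms by (intro tendsto_intros cf_form_over_cf_denom_tendsto) simp_all
  ultimately show ?thesis by (simp add: norm_mult norm_divide norm_minus_commute)
qed

section \<open>Conjugates of the tails\<close>

lemma algebraic_cf_tail:
  assumes "algebraic x"
  shows "algebraic (cf_tail x n)"
proof (induction n)
  case (Suc n)
  show ?case
    using algebraic_inverse[OF algebraic_diff_of_rat[OF Suc, of "of_int \<lfloor>cf_tail x n\<rfloor>"]]
    by (simp add: inverse_eq_divide)
qed (use assms in simp)

lemma conjugates_cf_tail:
  assumes "algebraic x" "x \<notin> \<rat>"
  shows "conjugates (cf_tail x n) = cf_tail_map x n ` conjugates x"
proof (induction n)
  case 0
  show ?case by (simp add: cf_tail_map_0)
next
  case (Suc n)
  let ?a = "of_int \<lfloor>cf_tail x n\<rfloor> :: rat"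
  have "conjugates (cf_tail x (Suc n)) = conjugates (inverse (cf_tail x n - of_rat ?a))"
    by (simp add: inverse_eq_divide)
  also have "\<dots> = inverse ` (\<lambda>z. z - of_rat ?a) ` conjugates (cf_tail x n)"
    using assms(1)
    by (simp only: conjugates_inverse conjugates_diff_of_rat algebraic_diff_of_rat
        algebraic_cf_tail)
  also have "\<dots> = cf_tail_map x (Suc n) ` conjugates x"
    using conjugates_not_Rats[OF assms]
    by (auto simp: Suc image_image cf_tail_map_Suc intro!: image_cong)
  finally show ?case .
qed

lemma proper_conjugates_cf_tail:
  assumes "algebraic x" "x \<notin> \<rat>"
  shows "conjugates (cf_tail x n) - {of_real (cf_tail x n)} =
           cf_tail_map x n ` (conjugates x - {of_real x})"
proof -
  have "inj_on (cf_tail_map x n) (conjugates x)"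
    using conjugates_not_Rats[OF assms] by (intro inj_on_subset[OF inj_on_cf_tail_map]) blast
  then have "cf_tail_map x n ` (conjugates x - {of_real x}) =
      cf_tail_map x n ` conjugates x - cf_tail_map x n ` {of_real x}"
    using of_real_in_conjugates[OF assms(1)] by (intro inj_on_image_set_diff) auto
  then show ?thesis
    using assms by (simp add: conjugates_cf_tail cf_tail_map_of_real cf_tail_map_self)
qed

theorem theorem2:
  fixes \<alpha> :: real and \<sigma>1 \<sigma>2 :: "real \<Rightarrow> complex"
  assumes "cubic_irrationality \<alpha>"
    and "\<And>\<gamma>. \<gamma> \<in> rat_adjoin \<alpha> \<Longrightarrow> \<gamma> \<notin> \<rat> \<Longrightarrow>
           \<sigma>1 \<gamma> \<noteq> \<sigma>2 \<gamma> \<and> conjugates \<gamma> - {complex_of_real \<gamma>} = {\<sigma>1 \<gamma>, \<sigma>2 \<gamma>}"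
  shows "(\<lambda>n. (real_of_int (cf_denom \<alpha> n))\<^sup>2 * cmod (\<sigma>1 (cf_tail \<alpha> n) - \<sigma>2 (cf_tail \<alpha> n)))
           \<longlonglongrightarrow> cmod ((\<sigma>1 \<alpha> - \<sigma>2 \<alpha>) /
                 ((complex_of_real \<alpha> - \<sigma>1 \<alpha>) * (complex_of_real \<alpha> - \<sigma>2 \<alpha>)))"
proof -
  have algebraic: "algebraic \<alpha>" and irrational: "\<alpha> \<notin> \<rat>"
    using assms(1) cubic_irrationality_not_Rats by (auto simp: cubic_irrationality_def)
  have conjugates_tail: "conjugates (cf_tail \<alpha> n) - {complex_of_real (cf_tail \<alpha> n)} =
      {\<sigma>1 (cf_tail \<alpha> n), \<sigma>2 (cf_tail \<alpha> n)}" for n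
    using assms(2) cf_tail_in_rat_adjoin cf_tail_irrational[OF irrational] by blast
  then have conjugates: "conjugates \<alpha> - {complex_of_real \<alpha>} = {\<sigma>1 \<alpha>, \<sigma>2 \<alpha>}"
    using conjugates_tail[of 0] by simp
  have "{\<sigma>1 (cf_tail \<alpha> n), \<sigma>2 (cf_tail \<alpha> n)} =
      {cf_tail_map \<alpha> n (\<sigma>1 \<alpha>), cf_tail_map \<alpha> n (\<sigma>2 \<alpha>)}" for n
    using proper_conjugates_cf_tail[OF algebraic irrational, of n]
    by (simp add: conjugates conjugates_tail)
  then have dist: "cmod (\<sigma>1 (cf_tail \<alpha> n) - \<sigma>2 (cf_tail \<alpha> n)) =
      cmod (cf_tail_map \<alpha> n (\<sigma>1 \<alpha>) - cf_tail_map \<alpha> n (\<sigma>2 \<alpha>))" for n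
    by (metis doubleton_eq_iff norm_minus_commute)
  have "\<sigma>1 \<alpha> \<notin> \<rat>" "\<sigma>2 \<alpha> \<notin> \<rat>" "\<sigma>1 \<alpha> \<noteq> of_real \<alpha>" "\<sigma>2 \<alpha> \<noteq> of_real \<alpha>"
    using conjugates conjugates_not_Rats[OF algebraic irrational] by blast+
  then show ?thesis
    unfolding dist using irrational by (intro cf_tail_map_dist_tendsto)
qed

end
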